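(* Let $(L,[\cdot,\cdot,\cdot],\alpha,\beta)$ be a $3$-Bihom-Lie algebra over a field $\mathbb{K}$. Then $L$ has a perfect product structure if and only if $L=L_+\oplus L_-$ (direct sum of vector spaces), where $L_+$ and $L_-$ are Bihom subalgebras of $L$ such that $[L_+,L_+,L_-]\subseteq L_-$, $[L_+,L_-,L_+]\subseteq L_-$, $[L_-,L_+,L_+]\subseteq L_-$, $[L_-,L_-,L_+]\subseteq L_+$, $[L_-,L_+,L_-]\subseteq L_+$ and $[L_+,L_-,L_-]\subseteq L_+$.
   Context: A $3$-Bihom-Lie algebra over a field $\mathbb{K}$ is a $4$-tuple $(L,[\cdot,\cdot,\cdot],\alpha,\beta)$ consisting of a $\mathbb{K}$-vector space $L$, a $3$-linear map $[\cdot,\cdot,\cdot]\colon L\times L\times L\to L$ and two linear maps $\alpha,\beta\colon L\to L$ such that for all $x,y,z,u,v\in L$: (1) $\alpha\beta=\beta\alpha$; (2) $\alpha([x,y,z])=[\alpha(x),\alpha(y),\alpha(z)]$ and $\beta([x,y,z])=[\beta(x),\beta(y),\beta(z)]$; (3) $[\beta(x),\beta(y),\alpha(z)]=-[\beta(y),\beta(x),\alpha(z)]=-[\beta(x),\beta(z),\alpha(y)]$; (4) $[\beta^2(u),\beta^2(v),[\beta(x),\beta(y),\alpha(z)]]=[\beta^2(y),\beta^2(z),[\beta(u),\beta(v),\alpha(x)]]-[\beta^2(x),\beta^2(z),[\beta(u),\beta(v),\alpha(y)]]+[\beta^2(x),\beta^2(y),[\beta(u),\beta(v),\alpha(z)]]$.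 A linear subspace $\eta\subseteq L$ is a Bihom subalgebra if $\alpha(\eta)\subseteq\eta$, $\beta(\eta)\subseteq\eta$ and $[x,y,z]\in\eta$ for all $x,y,z\in\eta$. An almost product structure on $L$ is a linear map $E\colon L\to L$ with $E^2=\mathrm{Id}$, $E\neq\pm\mathrm{Id}$, $\alpha E=E\alpha$ and $\beta E=E\beta$. An almost product structure $E$ is called a perfect product structure if $E[x,y,z]=[Ex,Ey,Ez]$ for all $x,y,z\in L$. For subspaces $A,B,C\subseteq L$, $[A,B,C]$ denotes the span of all $[a,b,c]$ with $a\in A$, $b\in B$, $c\in C$.
   Formalization: The formal statement requires L_+ and L_- to be nonzero and the field to have characteristic different from 2; without these the equivalence fails (e.g. L=K with zero bracket, or K=F_2, L=K^2, zero bracket, α=β=diag(0,1)). *)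

theory Defs
  imports Complex_Main
begin

locale bihom_lie3_algebra = vector_space scale
  for scale :: "'k::field \<Rightarrow> 'v::ab_group_add \<Rightarrow> 'v" +
  fixes br :: "'v \<Rightarrow> 'v \<Rightarrow> 'v \<Rightarrow> 'v"
    and \<alpha> \<beta> :: "'v \<Rightarrow> 'v"
  assumes linear_br1: "\<And>y z. Vector_Spaces.linear scale scale (\<lambda>x. br x y z)"
    and linear_br2: "\<And>x z. Vector_Spaces.linear scale scale (\<lambda>y. br x y z)"
    and linear_br3: "\<And>x y. Vector_Spaces.linear scale scale (\<lambda>z. br x y z)"
    and linear_alpha: "Vector_Spaces.linear scale scale \<alpha>"
    and linear_beta: "Vector_Spaces.linear scale scale \<beta>"
    and alpha_beta_commute: "\<alpha> \<circ> \<beta> = \<beta> \<circ> \<alpha>"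
    and alpha_br: "\<And>x y z. \<alpha> (br x y z) = br (\<alpha> x) (\<alpha> y) (\<alpha> z)"
    and beta_br: "\<And>x y z. \<beta> (br x y z) = br (\<beta> x) (\<beta> y) (\<beta> z)"
    and bihom_skew12: "\<And>x y z. br (\<beta> x) (\<beta> y) (\<alpha> z) = - br (\<beta> y) (\<beta> x) (\<alpha> z)"
    and bihom_skew23: "\<And>x y z. br (\<beta> x) (\<beta> y) (\<alpha> z) = - br (\<beta> x) (\<beta> z) (\<alpha> y)"
    and bihom_jacobi: "\<And>x y z u v.
      br (\<beta> (\<beta> u)) (\<beta> (\<beta> v)) (br (\<beta> x) (\<beta> y) (\<alpha> z)) =
        br (\<beta> (\<beta> y)) (\<beta> (\<beta> z)) (br (\<beta> u) (\<beta> v) (\<alpha> x))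
        - br (\<beta> (\<beta> x)) (\<beta> (\<beta> z)) (br (\<beta> u) (\<beta> v) (\<alpha> y))
        + br (\<beta> (\<beta> x)) (\<beta> (\<beta> y)) (br (\<beta> u) (\<beta> v) (\<alpha> z))"

definition bihom_subalgebra ::
  "('k::field \<Rightarrow> 'v::ab_group_add \<Rightarrow> 'v) \<Rightarrow> ('v \<Rightarrow> 'v \<Rightarrow> 'v \<Rightarrow> 'v) \<Rightarrow> ('v \<Rightarrow> 'v) \<Rightarrow> ('v \<Rightarrow> 'v) \<Rightarrow> 'v set \<Rightarrow> bool"
  where "bihom_subalgebra scale br \<alpha> \<beta> S \<longleftrightarrow>
    module.subspace scale S \<and> \<alpha> ` S \<subseteq> S \<and> \<beta> ` S \<subseteq> S \<and>
    (\<forall>x\<in>S. \<forall>y\<in>S. \<forall>z\<in>S. br x y z \<in> S)"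

definition almost_product_structure ::
  "('k::field \<Rightarrow> 'v::ab_group_add \<Rightarrow> 'v) \<Rightarrow> ('v \<Rightarrow> 'v) \<Rightarrow> ('v \<Rightarrow> 'v) \<Rightarrow> ('v \<Rightarrow> 'v) \<Rightarrow> bool"
  where "almost_product_structure scale \<alpha> \<beta> E \<longleftrightarrow>
    Vector_Spaces.linear scale scale E \<and> E \<circ> E = id \<and> E \<noteq> id \<and> E \<noteq> (\<lambda>x. - x) \<and>
    \<alpha> \<circ> E = E \<circ> \<alpha> \<and> \<beta> \<circ> E = E \<circ> \<beta>"

definition perfect_product_structure ::
  "('k::field \<Rightarrow> 'v::ab_group_add \<Rightarrow> 'v) \<Rightarrow> ('v \<Rightarrow> 'v \<Rightarrow> 'v \<Rightarrow> 'v) \<Rightarrow> ('v \<Rightarrow> 'v) \<Rightarrow> ('v \<Rightarrow> 'v) \<Rightarrow> ('v \<Rightarrow> 'v) \<Rightarrow> bool"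
  where "perfect_product_structure scale br \<alpha> \<beta> E \<longleftrightarrow>
    almost_product_structure scale \<alpha> \<beta> E \<and>
    (\<forall>x y z. E (br x y z) = br (E x) (E y) (E z))"

definition bracket_span ::
  "('k::field \<Rightarrow> 'v::ab_group_add \<Rightarrow> 'v) \<Rightarrow> ('v \<Rightarrow> 'v \<Rightarrow> 'v \<Rightarrow> 'v) \<Rightarrow> 'v set \<Rightarrow> 'v set \<Rightarrow> 'v set \<Rightarrow> 'v set"
  where "bracket_span scale br A B C =
    module.span scale {br a b c | a b c. a \<in> A \<and> b \<in> B \<and> c \<in> C}"

definition is_direct_sum ::
  "('k::field \<Rightarrow> 'v::ab_group_add \<Rightarrow> 'v) \<Rightarrow> 'v set \<Rightarrow> 'v set \<Rightarrow> bool"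
  where "is_direct_sum scale A B \<longleftrightarrow>
    module.subspace scale A \<and> module.subspace scale B \<and>
    {a + b | a b. a \<in> A \<and> b \<in> B} = UNIV \<and> A \<inter> B = {0}"

end

theory Submission
  imports Defs
begin

text \<open>A perfect product structure \<open>E\<close> is an involution, so, 2 being invertible, the space splits into
  the eigenspaces of \<open>E\<close> for the eigenvalues 1 and -1. That \<open>E\<close> preserves the bracket says that the
  bracket is graded by the two signs, which is the list of inclusions. Conversely, the reflection
  \<open>p + m \<mapsto> p - m\<close> of a graded decomposition is a perfect product structure.\<close>

context bihom_lie3_algebra
begin

lemmas br_hom =
  linear_br1[unfolded linear_iff_module_hom]
  linear_br2[unfolded linear_iff_module_hom]
  linear_br3[unfolded linear_iff_module_hom]

lemmas br_add = br_hom[THEN module_hom.add]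
lemmas br_minus = br_hom[THEN module_hom.neg]
lemmas br_diff = br_hom[THEN module_hom.diff]

text \<open>A subspace contains a span as soon as it contains the generators, so the inclusions of
  the grading can be checked on single brackets.\<close>

lemma bracket_span_subset_iff:
  assumes "subspace S"
  shows "bracket_span scale br A B C \<subseteq> S \<longleftrightarrow> (\<forall>a\<in>A. \<forall>b\<in>B. \<forall>c\<in>C. br a b c \<in> S)"
proof -
  have "span X \<subseteq> S \<longleftrightarrow> X \<subseteq> S" for X
    by (metis assms span_minimal span_superset subset_trans)
  then show ?thesis
    by (simp only: bracket_span_def) blast
qed

text \<open>The two nontriviality conditions are the counterpart of \<open>E\<close> being neither
  the identity nor its negative: the reflection would be the identity for \<open>M = {0}\<close> and
  minus the identity for \<open>P = {0}\<close>.\<close>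

definition sign_graded :: "'v set \<Rightarrow> 'v set \<Rightarrow> bool"
  where "sign_graded P M \<longleftrightarrow>
    is_direct_sum scale P M \<and> P \<noteq> {0} \<and> M \<noteq> {0} \<and>
    bihom_subalgebra scale br \<alpha> \<beta> P \<and> bihom_subalgebra scale br \<alpha> \<beta> M \<and>
    bracket_span scale br P P M \<subseteq> M \<and>
    bracket_span scale br P M P \<subseteq> M \<and>
    bracket_span scale br M P P \<subseteq> M \<and>
    bracket_span scale br M M P \<subseteq> P \<and>
    bracket_span scale br M P M \<subseteq> P \<and>
    bracket_span scale br P M M \<subseteq> P"

text \<open>The components of \<open>x\<close> are the averages \<open>(x + E x) / 2\<close> and
  \<open>(x - E x) / 2\<close>. A vector in both eigenspaces satisfies \<open>x = - x\<close>, hence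
  vanishes because 2 is invertible.\<close>

lemma involution_eigenspaces_direct_sum:
  assumes two: "(2::'k) \<noteq> 0"
    and lin: "Vector_Spaces.linear scale scale E"
    and inv: "\<And>x. E (E x) = x"
  shows "is_direct_sum scale {x. E x = x} {x. E x = - x}"
proof -
  note hom = lin[unfolded linear_iff_module_hom]
  note add = hom[THEN module_hom.add] and sc = hom[THEN module_hom.scale]
    and neg = hom[THEN module_hom.neg]
  have zero: "E 0 = 0"
    using add[of 0 0] by simp
  have half: "scale (inverse 2) (x + x) = x" for x
    using two by (metis scale_left_distrib one_add_one scale_one scale_scale left_inverse)
  have dec: "\<exists>a b. x = a + b \<and> E a = a \<and> E b = - b" for x
  proof (intro exI conjI)
    let ?a = "scale (inverse 2) (x + E x)" and ?b = "scale (inverse 2) (x - E x)"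
    have "?a + ?b = scale (inverse 2) (x + x)"
      by (simp flip: scale_right_distrib)
    then show "x = ?a + ?b"
      unfolding half by (rule sym)
    show "E ?a = ?a"
      by (simp add: sc add inv add.commute)
    have "E (x - E x) = - (x - E x)"
      using add[of x "- E x"] by (simp add: neg inv)
    then show "E ?b = - ?b"
      by (simp only: sc scale_minus_right)
  qed
  have "{a + b |a b. a \<in> {x. E x = x} \<and> b \<in> {x. E x = - x}} = UNIV"
    using dec by auto
  moreover have "x = 0" if "E x = x" "E x = - x" for x
    using that half[of x] by (metis add.right_inverse scale_zero_right)
  ultimately show ?thesis
    by (auto simp: is_direct_sum_def zero subspace_def add sc)
qed

text \<open>On eigenvectors, \<open>E\<close> multiplies a bracket by the product of the three
  signs. The bracket therefore lies in the eigenspace for 1 or -1 according to whether the number of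
  arguments from the latter is even or odd. In particular three arguments of sign -1 give sign -1,
  so that eigenspace too is closed under the bracket.\<close>

lemma perfect_product_structure_eigenspaces:
  assumes two: "(2::'k) \<noteq> 0" and E: "perfect_product_structure scale br \<alpha> \<beta> E"
  shows "sign_graded {x. E x = x} {x. E x = - x}"
proof -
  let ?P = "{x. E x = x}" and ?M = "{x. E x = - x}"
  have lin: "Vector_Spaces.linear scale scale E" and inv: "E (E x) = x"
    and not_id: "E \<noteq> id" "E \<noteq> (\<lambda>x. - x)"
    and comm: "E (\<alpha> x) = \<alpha> (E x)" "E (\<beta> x) = \<beta> (E x)"
    and br: "E (br x y z) = br (E x) (E y) (E z)" for x y z
    using E by (auto simp: perfect_product_structure_def almost_product_structure_def fun_eq_iff)
  note hom = lin[unfolded linear_iff_module_hom]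
  note add = hom[THEN module_hom.add] and neg = hom[THEN module_hom.neg]
  note ab_neg = linear_alpha[unfolded linear_iff_module_hom, THEN module_hom.neg]
    linear_beta[unfolded linear_iff_module_hom, THEN module_hom.neg]
  have ds: "is_direct_sum scale ?P ?M"
    by (rule involution_eigenspaces_direct_sum[OF two lin inv])
  then have sub: "subspace ?P" "subspace ?M"
    by (auto simp: is_direct_sum_def)
  \<comment> \<open>The unnormalised components suffice to produce nonzero eigenvectors: some
    \<open>x - E x\<close> is nonzero because \<open>E\<close> is not the identity, and some
    \<open>y + E y\<close> because \<open>E\<close> is not its negative.\<close>
  have "x + E x \<in> ?P" "x - E x \<in> ?M" for x
    using add[of x "- E x"] by (simp_all add: add neg inv add.commute)
  moreover obtain x where "x - E x \<noteq> 0"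
    using not_id(1) by (metis eq_id_iff right_minus_eq)
  moreover obtain y where "y + E y \<noteq> 0"
    using not_id(2) by (metis add.commute eq_neg_iff_add_eq_0)
  ultimately have "?P \<noteq> {0}" "?M \<noteq> {0}"
    by blast+
  then show ?thesis
    unfolding sign_graded_def
    by (simp add: ds bracket_span_subset_iff bihom_subalgebra_def sub br br_minus comm ab_neg
        image_subset_iff)
qed

lemma direct_sum_reflection:
  assumes ds: "is_direct_sum scale P M"
  obtains E where "\<And>p m. p \<in> P \<Longrightarrow> m \<in> M \<Longrightarrow> E (p + m) = p - m"
proof -
  have sub: "subspace P" "subspace M" and int: "P \<inter> M = {0}"
    and sum: "{a + b | a b. a \<in> P \<and> b \<in> M} = UNIV"
    using ds by (auto simp: is_direct_sum_def)
  have uniq: "p = q \<and> m = n"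
    if "p \<in> P" "q \<in> P" "m \<in> M" "n \<in> M" "p + m = q + n" for p q m n
  proof -
    \<comment> \<open>This difference lies in both summands, hence in their intersection.\<close>
    have eq: "p - q = n - m"
      using that(5) by (simp add: algebra_simps)
    have "p - q \<in> P" "n - m \<in> M"
      using that sub by (blast intro: subspace_diff)+
    with eq int have "p - q = 0"
      by (metis IntI singletonD)
    with eq show ?thesis
      by simp
  qed
  \<comment> \<open>Quantifying over all decompositions of \<open>x\<close> turns well-definedness
    into the existence of one value per vector, from which \<open>E\<close> is obtained by
    choice.\<close>
  have "\<exists>y. \<forall>p\<in>P. \<forall>m\<in>M. x = p + m \<longrightarrow> y = p - m" for x
  proof -
    obtain p m where "p \<in> P" "m \<in> M" "x = p + m"
      using sum by blast
    then show ?thesis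
      using uniq by (intro exI[of _ "p - m"]) blast
  qed
  then obtain E where "\<And>x p m. p \<in> P \<Longrightarrow> m \<in> M \<Longrightarrow> x = p + m \<Longrightarrow> E x = p - m"
    by metis
  then show thesis
    by (intro that[of E]) blast
qed

lemma sign_graded_reflection:
  assumes two: "(2::'k) \<noteq> 0" and graded: "sign_graded P M"
    and E: "\<And>p m. p \<in> P \<Longrightarrow> m \<in> M \<Longrightarrow> E (p + m) = p - m"
  shows "perfect_product_structure scale br \<alpha> \<beta> E"
proof -
  have sub: "subspace P" "subspace M" and sum: "{a + b | a b. a \<in> P \<and> b \<in> M} = UNIV"
    and nontriv: "P \<noteq> {0}" "M \<noteq> {0}"
    and closed: "\<And>x. x \<in> P \<Longrightarrow> \<alpha> x \<in> P" "\<And>x. x \<in> P \<Longrightarrow> \<beta> x \<in> P"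
      "\<And>x. x \<in> M \<Longrightarrow> \<alpha> x \<in> M" "\<And>x. x \<in> M \<Longrightarrow> \<beta> x \<in> M"
    using graded
    by (auto simp: sign_graded_def is_direct_sum_def bihom_subalgebra_def image_subset_iff)
  \<comment> \<open>The eight kinds of brackets, sorted by parity: zero or two arguments from
    \<open>M\<close> lead to \<open>P\<close>, one or three lead to \<open>M\<close>.\<close>
  have brP: "br p q r \<in> P" "br m n r \<in> P" "br m q k \<in> P" "br p n k \<in> P"
    and brM: "br m n k \<in> M" "br p q k \<in> M" "br p n r \<in> M" "br m q r \<in> M"
    if "p \<in> P" "q \<in> P" "r \<in> P" "m \<in> M" "n \<in> M" "k \<in> M" for p q r m n k
    using graded that
    by (simp_all add: sign_graded_def bihom_subalgebra_def bracket_span_subset_iff sub)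
  have dec: "\<exists>p\<in>P. \<exists>m\<in>M. x = p + m" for x
    using sum by blast
  have E_add: "E (x + y) = E x + E y" for x y
  proof -
    obtain p m q n where *: "p \<in> P" "m \<in> M" "q \<in> P" "n \<in> M" "x = p + m" "y = q + n"
      using dec by meson
    then have "E ((p + q) + (m + n)) = (p + q) - (m + n)"
      using sub by (intro E subspace_add)
    moreover have "x + y = (p + q) + (m + n)"
      using * by (simp add: algebra_simps)
    ultimately show ?thesis
      using * by (simp only: E) (simp add: algebra_simps)
  qed
  have E_scale: "E (scale c x) = scale c (E x)" for c x
  proof -
    obtain p m where "p \<in> P" "m \<in> M" "x = p + m"
      using dec by meson
    then show ?thesis
      using sub E by (simp add: scale_right_distrib scale_right_diff_distrib subspace_scale)
  qed
  have EE: "E (E x) = x" for x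
  proof -
    obtain p m where "p \<in> P" "m \<in> M" "x = p + m"
      using dec by meson
    \<comment> \<open>Since \<open>E x = p + (- m)\<close> is again a decomposition, a second
      reflection restores the sign of \<open>m\<close>.\<close>
    then show ?thesis
      using E[of p "- m"] sub by (simp add: E subspace_neg)
  qed
  note alpha_hom = linear_alpha[unfolded linear_iff_module_hom]
    and beta_hom = linear_beta[unfolded linear_iff_module_hom]
  note ab = alpha_hom[THEN module_hom.add] alpha_hom[THEN module_hom.diff]
    beta_hom[THEN module_hom.add] beta_hom[THEN module_hom.diff]
  have comm: "\<alpha> (E x) = E (\<alpha> x)" "\<beta> (E x) = E (\<beta> x)" for x
  proof -
    obtain p m where "p \<in> P" "m \<in> M" "x = p + m"
      using dec by meson
    then show "\<alpha> (E x) = E (\<alpha> x)" "\<beta> (E x) = E (\<beta> x)"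
      by (simp_all add: E ab closed)
  qed
  have br: "E (br x y z) = br (E x) (E y) (E z)" for x y z
  proof -
    obtain p m q n r k where *: "p \<in> P" "m \<in> M" "q \<in> P" "n \<in> M" "r \<in> P" "k \<in> M"
      "x = p + m" "y = q + n" "z = r + k"
      using dec by meson
    \<comment> \<open>The even and the odd half of the trilinear expansion of
      \<open>br x y z\<close>; they are its components in \<open>P\<close> and
      \<open>M\<close>.\<close>
    let ?p = "br p q r + br m n r + br m q k + br p n k"
    let ?m = "br m n k + br p q k + br p n r + br m q r"
    have "br x y z = ?p + ?m"
      by (simp add: * br_add algebra_simps)
    moreover have "?p \<in> P" "?m \<in> M"
      by (intro subspace_add sub brP[OF *(1,3,5,2,4,6)] brM[OF *(1,3,5,2,4,6)])+
    ultimately have "E (br x y z) = ?p - ?m"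
      by (simp add: E)
    \<comment> \<open>Negating \<open>m\<close>, \<open>n\<close> and \<open>k\<close> changes the
      sign of exactly the terms with an odd number of them, that is, of the odd half.\<close>
    also have "\<dots> = br (p - m) (q - n) (r - k)"
      by (simp add: br_diff algebra_simps)
    finally show ?thesis
      using * by (simp add: E)
  qed
  \<comment> \<open>Together with the nontriviality of \<open>P\<close> and \<open>M\<close> this
    rules out the identity and its negative: a nonzero vector cannot be both fixed and negated by
    \<open>E\<close>.\<close>
  have eq_minus: "x = 0" if "x = - x" for x :: 'v
  proof -
    have "scale 2 x = x + x"
      by (metis one_add_one scale_left_distrib scale_one)
    also have "\<dots> = 0"
      using that by (metis add.right_inverse)
    finally show ?thesis
      using two by simp
  qed
  have E_P: "E p = p" if "p \<in> P" for p
    using E[of p 0] that sub by (simp add: subspace_0)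
  have E_M: "E m = - m" if "m \<in> M" for m
    using E[of 0 m] that sub by (simp add: subspace_0)
  obtain p where "p \<in> P" "p \<noteq> 0"
    using nontriv sub subspace_0 by blast
  then have "E \<noteq> (\<lambda>x. - x)"
    using E_P eq_minus by metis
  moreover obtain m where "m \<in> M" "m \<noteq> 0"
    using nontriv sub subspace_0 by blast
  then have "E \<noteq> id"
    using E_M eq_minus by (metis id_apply)
  moreover have "Vector_Spaces.linear scale scale E"
    by (simp add: linear_iff_module_hom module_hom_iff module_axioms E_add E_scale)
  ultimately show ?thesis
    by (simp add: perfect_product_structure_def almost_product_structure_def fun_eq_iff EE comm br)
qed

theorem ex_perfect_product_structure_iff:
  assumes "(2::'k) \<noteq> 0"
  shows "(\<exists>E. perfect_product_structure scale br \<alpha> \<beta> E) \<longleftrightarrow> (\<exists>P M. sign_graded P M)"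
proof
  assume "\<exists>E. perfect_product_structure scale br \<alpha> \<beta> E"
  then show "\<exists>P M. sign_graded P M"
    using perfect_product_structure_eigenspaces[OF assms] by blast
next
  assume "\<exists>P M. sign_graded P M"
  then obtain P M where graded: "sign_graded P M"
    by blast
  then obtain E where "\<And>p m. p \<in> P \<Longrightarrow> m \<in> M \<Longrightarrow> E (p + m) = p - m"
    using direct_sum_reflection by (auto simp: sign_graded_def)
  from sign_graded_reflection[OF assms graded this]
  show "\<exists>E. perfect_product_structure scale br \<alpha> \<beta> E"
    by blast
qed

end

theorem corollary3p17:
  fixes scale :: "'k::field \<Rightarrow> 'v::ab_group_add \<Rightarrow> 'v"
    and br :: "'v \<Rightarrow> 'v \<Rightarrow> 'v \<Rightarrow> 'v"
    and \<alpha> \<beta> :: "'v \<Rightarrow> 'v"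
  assumes "bihom_lie3_algebra scale br \<alpha> \<beta>"
    and "(2::'k) \<noteq> 0"
  shows "(\<exists>E. perfect_product_structure scale br \<alpha> \<beta> E) \<longleftrightarrow>
    (\<exists>Lp Lm. is_direct_sum scale Lp Lm \<and> Lp \<noteq> {0} \<and> Lm \<noteq> {0} \<and>
      bihom_subalgebra scale br \<alpha> \<beta> Lp \<and> bihom_subalgebra scale br \<alpha> \<beta> Lm \<and>
      bracket_span scale br Lp Lp Lm \<subseteq> Lm \<and>
      bracket_span scale br Lp Lm Lp \<subseteq> Lm \<and>
      bracket_span scale br Lm Lp Lp \<subseteq> Lm \<and>
      bracket_span scale br Lm Lm Lp \<subseteq> Lp \<and>
      bracket_span scale br Lm Lp Lm \<subseteq> Lp \<and>
      bracket_span scale br Lp Lm Lm \<subseteq> Lp)"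
proof -
  interpret bihom_lie3_algebra scale br \<alpha> \<beta>
    by (rule assms(1))
  show ?thesis
    using ex_perfect_product_structure_iff[OF assms(2)] unfolding sign_graded_def .
qed

end
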